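(* For any finite list $A$ of chess-piece types, the structure of chess $\mathfrak{Ch}_A$, consisting of the finite positions of infinite chess with piece specification $A$ and equipped with the relations $\mathrm{WhiteToPlay}$, $\mathrm{OneMove}$, $\mathrm{BlackInCheck}$ and $\mathrm{WhiteInCheck}$, is automatic.
   Context: **Infinite chess** is chess played on the infinite edgeless board $\mathbb{Z}\times\mathbb{Z}$. **Positions.** A piece designation is a tuple $\langle i,j,x,y\rangle$ where $i\in\{K,k,Q,q,B,b,N,n,R,r,P,p\}$ is the piece type (king, queen, bishop, knight, rook, pawn; upper case white, lower case black), $j$ is a binary indicator of whether the piece is in play (live) or captured, and $(x,y)\in\mathbb{Z}\times\mathbb{Z}$ is its location (a fixed default value if captured). A finite position is a finite sequence of piece designations, with at most one king of each color and no two live pieces on the same square, together with a binary indicator of whose turn it is. A list $A$ of chess-piece types is a finite sequence of elements of $\{K,k,Q,q,B,b,N,n,R,r,P,p\}$ (with at most one $K$ and at most one $k$); a position has piece specification $A$ if the sequence of types of its piece designations, in order, is exactly $A$ (some of the pieces may be captured). **Moves.** Pieces move and capture by the usual chess rules: a king to any of the 8 adjacent squares; a knight by $(\pm1,\pm2)$ or $(\pm2,\pm1)$, with no obstruction possible; rooks along ranks and files, bishops along diagonals, queens along either, any positive distance, with no live piece strictly between; a white pawn advances by $(0,+1)$ to an empty square or captures an opposing piece by $(\pm1,+1)$; a black pawn advances by $(0,-1)$ to an empty square or captures by $(\pm1,-1)$. There is no pawn promotion, no initial two-step pawn move, no en passant and no castling. A piece attacks a square if it is live and could move so as to capture an opposing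 piece on that square, irrespective of whether a friendly piece is there and irrespective of pins. A player is in check if that player's king is live and attacked by a live opposing piece. A legal move is a move by the player whose turn it is, to a square not occupied by a friendly piece (any opposing piece there being captured), after which the moving player is not in check; the turn then passes to the opponent. **The structure $\mathfrak{Ch}_A$.** Its domain is the set of all finite positions with piece specification $A$. Its relations are: $\mathrm{WhiteToPlay}(p)$, it is white's turn in $p$; $\mathrm{OneMove}(p,q)$, some legal move transforms $p$ into $q$, where the order of listing of the pieces is preserved and captured pieces remain listed but are marked captured (with the default location); $\mathrm{BlackInCheck}(p)$ and $\mathrm{WhiteInCheck}(p)$, black (respectively white) is in check in $p$. **Automatic.** A relational structure is automatic if its elements can be represented as finite strings over a finite alphabet so that the set of representing strings is a regular language and each relation is regular, where a $k$-ary relation on strings is regular if the set of convolutions of its tuples (the $k$ strings padded at the end with a new symbol to a common length and read synchronously as one string over the product alphabet) is a regular language. *)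

theory Defs
  imports Main
begin

section \<open>Regular languages and automatic structures\<close>

record 'a dfa =
  dfa_states :: "nat set"
  dfa_init :: nat
  dfa_next :: "nat \<Rightarrow> 'a \<Rightarrow> nat"
  dfa_final :: "nat set"

definition wf_dfa :: "'a set \<Rightarrow> 'a dfa \<Rightarrow> bool" where
  "wf_dfa \<Sigma> M \<longleftrightarrow>
     finite (dfa_states M) \<and> dfa_init M \<in> dfa_states M \<and> dfa_final M \<subseteq> dfa_states M \<and>
     (\<forall>s \<in> dfa_states M. \<forall>a \<in> \<Sigma>. dfa_next M s a \<in> dfa_states M)"

definition dfa_language :: "'a set \<Rightarrow> 'a dfa \<Rightarrow> 'a list set" where
  "dfa_language \<Sigma> M = {w \<in> lists \<Sigma>. foldl (dfa_next M) (dfa_init M) w \<in> dfa_final M}"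

definition regular_language :: "'a set \<Rightarrow> 'a list set \<Rightarrow> bool" where
  "regular_language \<Sigma> L \<longleftrightarrow> finite \<Sigma> \<and> (\<exists>M. wf_dfa \<Sigma> M \<and> L = dfa_language \<Sigma> M)"

text \<open>The padding symbol is \<^const>\<open>None\<close>; a letter of the product alphabet is a list with one
  entry per word. The \<open>0\<close> only makes the maximum defined for the empty tuple.\<close>

definition conv_words :: "'a list list \<Rightarrow> 'a option list list" where
  "conv_words ws =
     map (\<lambda>n. map (\<lambda>w. if n < length w then Some (w ! n) else None) ws)
       [0..<Max (insert 0 (length ` set ws))]"

definition product_alphabet :: "'a set \<Rightarrow> nat \<Rightarrow> 'a option list set" where
  "product_alphabet \<Sigma> k = {a. length a = k \<and> set a \<subseteq> insert None (Some ` \<Sigma>)}"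

definition regular_relation :: "'a set \<Rightarrow> nat \<Rightarrow> 'a list list set \<Rightarrow> bool" where
  "regular_relation \<Sigma> k R \<longleftrightarrow>
     R \<subseteq> {ws. length ws = k \<and> set ws \<subseteq> lists \<Sigma>} \<and>
     regular_language (product_alphabet \<Sigma> k) (conv_words ` R)"

text \<open>A relational structure: a domain and a finite family of relations, each given with its arity
  as a set of tuples.\<close>

record 'a rel_structure =
  universe :: "'a set"
  relations :: "(nat \<times> 'a list set) list"

text \<open>Every element is represented by exactly one word. Taking letters in \<^typ>\<open>nat\<close>
  loses no generality, since every finite alphabet embeds there; likewise for the states of
  a DFA above.\<close>

definition automatic :: "'a rel_structure \<Rightarrow> bool" where
  "automatic S \<longleftrightarrow>
     (\<exists>(\<Sigma> :: nat set) (rep :: 'a \<Rightarrow> nat list).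
        finite \<Sigma> \<and> inj_on rep (universe S) \<and>
        regular_language \<Sigma> (rep ` universe S) \<and>
        (\<forall>(k, R) \<in> set (relations S). regular_relation \<Sigma> k (map rep ` R)))"


section \<open>Positions of infinite chess\<close>

datatype color = White | Black

datatype piece_kind = King | Queen | Bishop | Knight | Rook | Pawn

type_synonym piece_type = "color \<times> piece_kind"

type_synonym square = "int \<times> int"

fun opponent :: "color \<Rightarrow> color" where
  "opponent White = Black"
| "opponent Black = White"

record piece =
  ptype :: piece_type
  live :: bool
  loc :: square

abbreviation pcolor :: "piece \<Rightarrow> color" where "pcolor a \<equiv> fst (ptype a)"
abbreviation pkind :: "piece \<Rightarrow> piece_kind" where "pkind a \<equiv> snd (ptype a)"

record position =
  pieces :: "piece list"
  turn :: color

definition default_loc :: square where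
  "default_loc = (0, 0)"

definition piece_list :: "piece_type list \<Rightarrow> bool" where
  "piece_list A \<longleftrightarrow> (\<forall>c. count_list A (c, King) \<le> 1)"

definition valid_position :: "position \<Rightarrow> bool" where
  "valid_position p \<longleftrightarrow>
     piece_list (map ptype (pieces p)) \<and>
     (\<forall>a \<in> set (pieces p). \<not> live a \<longrightarrow> loc a = default_loc) \<and>
     (\<forall>i < length (pieces p). \<forall>j < length (pieces p).
        live (pieces p ! i) \<and> live (pieces p ! j) \<and> loc (pieces p ! i) = loc (pieces p ! j) \<longrightarrow> i = j)"

definition positions :: "piece_type list \<Rightarrow> position set" where
  "positions A = {p. valid_position p \<and> map ptype (pieces p) = A}"


section \<open>Moves and checks\<close>

definition occupied :: "position \<Rightarrow> square \<Rightarrow> bool" where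
  "occupied p t \<longleftrightarrow> (\<exists>a \<in> set (pieces p). live a \<and> loc a = t)"

definition occupied_by :: "color \<Rightarrow> position \<Rightarrow> square \<Rightarrow> bool" where
  "occupied_by c p t \<longleftrightarrow> (\<exists>a \<in> set (pieces p). live a \<and> pcolor a = c \<and> loc a = t)"

definition straight_dirs :: "(int \<times> int) set" where
  "straight_dirs = {(1, 0), (-1, 0), (0, 1), (0, -1)}"

definition diagonal_dirs :: "(int \<times> int) set" where
  "diagonal_dirs = {(1, 1), (1, -1), (-1, 1), (-1, -1)}"

definition slides :: "(int \<times> int) set \<Rightarrow> position \<Rightarrow> square \<Rightarrow> square \<Rightarrow> bool" where
  "slides D p s t \<longleftrightarrow>
     (\<exists>(dx, dy) \<in> D. \<exists>n > 0.
        t = (fst s + n * dx, snd s + n * dy) \<and>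
        (\<forall>m. 0 < m \<and> m < n \<longrightarrow> \<not> occupied p (fst s + m * dx, snd s + m * dy)))"

fun forward :: "color \<Rightarrow> int" where
  "forward White = 1"
| "forward Black = -1"

fun reaches :: "position \<Rightarrow> piece_type \<Rightarrow> square \<Rightarrow> square \<Rightarrow> bool" where
  "reaches p (c, King) s t \<longleftrightarrow>
     t \<noteq> s \<and> \<bar>fst t - fst s\<bar> \<le> 1 \<and> \<bar>snd t - snd s\<bar> \<le> 1"
| "reaches p (c, Knight) s t \<longleftrightarrow>
     (\<bar>fst t - fst s\<bar> = 1 \<and> \<bar>snd t - snd s\<bar> = 2) \<or> (\<bar>fst t - fst s\<bar> = 2 \<and> \<bar>snd t - snd s\<bar> = 1)"
| "reaches p (c, Rook) s t \<longleftrightarrow> slides straight_dirs p s t"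
| "reaches p (c, Bishop) s t \<longleftrightarrow> slides diagonal_dirs p s t"
| "reaches p (c, Queen) s t \<longleftrightarrow> slides (straight_dirs \<union> diagonal_dirs) p s t"
| "reaches p (c, Pawn) s t \<longleftrightarrow>
     \<bar>fst t - fst s\<bar> = 1 \<and> snd t = snd s + forward c"

definition attacks :: "position \<Rightarrow> piece \<Rightarrow> square \<Rightarrow> bool" where
  "attacks p a t \<longleftrightarrow> live a \<and> reaches p (ptype a) (loc a) t"

definition in_check :: "color \<Rightarrow> position \<Rightarrow> bool" where
  "in_check c p \<longleftrightarrow>
     (\<exists>k \<in> set (pieces p). live k \<and> ptype k = (c, King) \<and>
        (\<exists>a \<in> set (pieces p). pcolor a = opponent c \<and> attacks p a (loc k)))"

text \<open>Only a pawn's captures are governed by \<^const>\<open>attacks\<close>; its advance is a separate case.\<close>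

definition can_move :: "position \<Rightarrow> piece \<Rightarrow> square \<Rightarrow> bool" where
  "can_move p a t \<longleftrightarrow>
     live a \<and> \<not> occupied_by (pcolor a) p t \<and>
     (if pkind a = Pawn
      then (t = (fst (loc a), snd (loc a) + forward (pcolor a)) \<and> \<not> occupied p t) \<or>
           (attacks p a t \<and> occupied_by (opponent (pcolor a)) p t)
      else attacks p a t)"

text \<open>The \<open>i\<close>-th piece goes to \<open>t\<close>, and any live piece standing there is captured.\<close>

definition make_move :: "position \<Rightarrow> nat \<Rightarrow> square \<Rightarrow> position" where
  "make_move p i t =
     \<lparr> pieces = map (\<lambda>j. let a = pieces p ! j in
                     if j = i then a\<lparr>loc := t\<rparr>
                     else if live a \<and> loc a = t then a\<lparr>live := False, loc := default_loc\<rparr>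
                     else a)
                [0..<length (pieces p)],
       turn = opponent (turn p) \<rparr>"

definition one_move :: "position \<Rightarrow> position \<Rightarrow> bool" where
  "one_move p q \<longleftrightarrow>
     (\<exists>i < length (pieces p). \<exists>t.
        pcolor (pieces p ! i) = turn p \<and> can_move p (pieces p ! i) t \<and>
        q = make_move p i t \<and> \<not> in_check (turn p) q)"


section \<open>The structure of chess\<close>

definition chess_structure :: "piece_type list \<Rightarrow> position rel_structure" where
  "chess_structure A =
     \<lparr> universe = positions A,
       relations =
         [(1, {[p] |p. p \<in> positions A \<and> turn p = White}),
          (2, {[p, q] |p q. p \<in> positions A \<and> q \<in> positions A \<and> one_move p q}),
          (1, {[p] |p. p \<in> positions A \<and> in_check Black p}),
          (1, {[p] |p. p \<in> positions A \<and> in_check White p})] \<rparr>"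

end

theory Submission
  imports Defs
begin

text \<open>
  The number of pieces is fixed by \<open>A\<close>, so a position is an integer vector of fixed length:
  a liveness flag and two coordinates for each piece, and one entry for the turn. In these terms all
  four relations are Boolean combinations of linear inequalities. The only quantifiers in the rules
  that range over infinitely many values can be eliminated by hand: the target square of a move is
  the location of the moved piece afterwards, so it can be read off the second position; and
  ``no piece stands strictly between'' on a line speaks about each of the finitely many pieces, whose
  distance along the line is a linear function of its coordinates (\<open>slides_along_linear\<close>).
  The relations are thus quantifier-free Presburger predicates, and the automata need not be
  closed under projection.

  Such predicates are recognised by finite automata (\<open>automatic_if_presburger\<close>).
  Integers are written in balanced ternary, least significant digit first, with one letter for the
  digits of all entries of the vector at one place. Every integer has exactly one such
  expansion with finitely many nonzero digits, signs included. A vector is therefore represented by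
  exactly one word without trailing zero letters, and the padding of a convolution simply stands for
  further zero digits. When an automaton checks \<open>h v \<le> c\<close> for a linear form \<open>h\<close>
  and reads the first digits \<open>d\<close> of \<open>v = d + 3 v'\<close>, it must go on to check
  \<open>h v' \<le> (c - h d) div 3\<close>, and only finitely many bounds \<open>c\<close> arise in this way.
  Boolean combinations preserve regularity. The automata are not written down but obtained from the
  criterion that a language is regular if it has finitely many residuals
  (\<open>regular_language_if_finite_residuals\<close>).
\<close>

section \<open>Regularity through residuals\<close>

definition residual :: "'a list \<Rightarrow> 'a list set \<Rightarrow> 'a list set" where
  "residual u L = {w. u @ w \<in> L}"

definition finite_residuals :: "'a set \<Rightarrow> 'a list set \<Rightarrow> bool" where
  "finite_residuals \<Sigma> L \<longleftrightarrow> finite ((\<lambda>u. residual u L) ` lists \<Sigma>)"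

lemma residual_append: "residual (u @ w) L = residual w (residual u L)"
  by (simp add: residual_def)

text \<open>Residuals are shown to be finitely many by exhibiting a finite family of languages that is
  closed under removing a first letter; the family plays the role of the state set.\<close>

lemma finite_residualsI:
  assumes "finite F" and "L \<in> F"
    and step: "\<And>K a. K \<in> F \<Longrightarrow> a \<in> \<Sigma> \<Longrightarrow> residual [a] K \<in> F"
  shows "finite_residuals \<Sigma> L"
proof -
  have "residual u K \<in> F" if "u \<in> lists \<Sigma>" "K \<in> F" for u K
    using that
  proof (induction u arbitrary: K)
    case Nil
    then show ?case by (simp add: residual_def)
  next
    case (Cons a u)
    then show ?case
      using residual_append[of "[a]" u K] step by simp
  qed
  then have "(\<lambda>u. residual u L) ` lists \<Sigma> \<subseteq> F"
    using \<open>L \<in> F\<close> by blast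
  then show ?thesis
    unfolding finite_residuals_def using \<open>finite F\<close> by (rule finite_subset)
qed

lemma finite_residuals_Compl:
  assumes "finite_residuals \<Sigma> L"
  shows "finite_residuals \<Sigma> (- L)"
proof -
  have "(\<lambda>u. residual u (- L)) ` lists \<Sigma> = uminus ` (\<lambda>u. residual u L) ` lists \<Sigma>"
    by (auto simp: residual_def image_image Compl_eq intro!: image_cong)
  then show ?thesis
    using assms by (simp add: finite_residuals_def)
qed

lemma finite_residuals_Int:
  assumes "finite_residuals \<Sigma> L" and "finite_residuals \<Sigma> K"
  shows "finite_residuals \<Sigma> (L \<inter> K)"
proof -
  let ?RL = "(\<lambda>u. residual u L) ` lists \<Sigma>" and ?RK = "(\<lambda>u. residual u K) ` lists \<Sigma>"
  have "(\<lambda>u. residual u (L \<inter> K)) ` lists \<Sigma> \<subseteq> (\<lambda>(X, Y). X \<inter> Y) ` (?RL \<times> ?RK)"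
  proof
    fix X assume "X \<in> (\<lambda>u. residual u (L \<inter> K)) ` lists \<Sigma>"
    then obtain u where u: "u \<in> lists \<Sigma>" "X = residual u (L \<inter> K)" by blast
    then have "X = (\<lambda>(X, Y). X \<inter> Y) (residual u L, residual u K)"
      by (auto simp: residual_def)
    then show "X \<in> (\<lambda>(X, Y). X \<inter> Y) ` (?RL \<times> ?RK)"
      using u by blast
  qed
  then show ?thesis
    using assms unfolding finite_residuals_def
    by (meson finite_SigmaI finite_imageI finite_subset)
qed

text \<open>One half of the Myhill--Nerode theorem: the residuals themselves serve as states, with an
  arbitrary numbering because states have to be natural numbers.\<close>

lemma regular_language_if_finite_residuals:
  assumes "finite \<Sigma>" and fin: "finite_residuals \<Sigma> L"
  shows "regular_language \<Sigma> {w \<in> lists \<Sigma>. w \<in> L}"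
proof -
  define Q where "Q = (\<lambda>u. residual u L) ` lists \<Sigma>"
  have "finite Q"
    using fin by (simp add: Q_def finite_residuals_def)
  then obtain g :: "'a list set \<Rightarrow> nat" where g: "inj_on g Q"
    using finite_imp_inj_to_nat_seg by blast
  have L_in: "L \<in> Q"
    unfolding Q_def by (rule image_eqI[of _ _ "[]"]) (auto simp: residual_def)
  have step: "residual [a] K \<in> Q" if "K \<in> Q" "a \<in> \<Sigma>" for K a
  proof -
    obtain u where "u \<in> lists \<Sigma>" "K = residual u L"
      using \<open>K \<in> Q\<close> by (auto simp: Q_def)
    then show ?thesis
      using \<open>a \<in> \<Sigma>\<close> unfolding Q_def
      by (intro image_eqI[of _ _ "u @ [a]"]) (auto simp: residual_append)
  qed
  define M :: "'a dfa" where "M =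
    \<lparr> dfa_states = g ` Q, dfa_init = g L,
      dfa_next = (\<lambda>s a. g (residual [a] (inv_into Q g s))),
      dfa_final = g ` {K \<in> Q. [] \<in> K} \<rparr>"
  have wf: "wf_dfa \<Sigma> M"
    using \<open>finite Q\<close> L_in step g by (auto simp: wf_dfa_def M_def)
  have run: "foldl (dfa_next M) (g K) w = g (residual w K) \<and> residual w K \<in> Q"
    if "w \<in> lists \<Sigma>" "K \<in> Q" for w K
    using that
  proof (induction w arbitrary: K)
    case Nil
    then show ?case by (simp add: residual_def)
  next
    case (Cons a w)
    have "dfa_next M (g K) a = g (residual [a] K)"
      using g \<open>K \<in> Q\<close> by (simp add: M_def)
    moreover have "residual (a # w) K = residual w (residual [a] K)"
      using residual_append[of "[a]" w K] by simp
    ultimately show ?case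
      using Cons.IH[of "residual [a] K"] Cons.hyps Cons.prems step[of K a] by simp
  qed
  have "foldl (dfa_next M) (g L) w \<in> dfa_final M \<longleftrightarrow> w \<in> L" if "w \<in> lists \<Sigma>" for w
  proof -
    have "g (residual w L) \<in> g ` {K \<in> Q. [] \<in> K} \<longleftrightarrow> [] \<in> residual w L"
      using run[OF that L_in] inj_on_image_mem_iff[OF g, of "residual w L" "{K \<in> Q. [] \<in> K}"]
      by simp
    then show ?thesis
      using run[OF that L_in] by (simp add: M_def residual_def)
  qed
  then have "{w \<in> lists \<Sigma>. w \<in> L} = dfa_language \<Sigma> M"
    by (auto simp: dfa_language_def M_def)
  then show ?thesis
    using wf \<open>finite \<Sigma>\<close> by (auto simp: regular_language_def)
qed

section \<open>Quantifier-free Presburger predicates\<close>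

text \<open>A valuation \<open>v\<close> assigns to \<open>i\<close> and \<open>j\<close> the \<open>j\<close>-th
  entry of the \<open>i\<close>-th vector of a tuple. Terms and formulas are identified with the functions
  of the valuation that they denote, so that definitions can be shown to be Presburger by
  unfolding them.\<close>

inductive affine :: "((nat \<Rightarrow> nat \<Rightarrow> int) \<Rightarrow> int) \<Rightarrow> bool" where
  const: "affine (\<lambda>v. c)"
| var: "affine (\<lambda>v. v i j)"
| add: "affine s \<Longrightarrow> affine t \<Longrightarrow> affine (\<lambda>v. s v + t v)"
| scale: "affine t \<Longrightarrow> affine (\<lambda>v. c * t v)"

inductive presburger :: "((nat \<Rightarrow> nat \<Rightarrow> int) \<Rightarrow> bool) \<Rightarrow> bool" where
  le: "affine s \<Longrightarrow> affine t \<Longrightarrow> presburger (\<lambda>v. s v \<le> t v)"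
| neg: "presburger P \<Longrightarrow> presburger (\<lambda>v. \<not> P v)"
| conj: "presburger P \<Longrightarrow> presburger Q \<Longrightarrow> presburger (\<lambda>v. P v \<and> Q v)"

lemma affine_diff: "affine s \<Longrightarrow> affine t \<Longrightarrow> affine (\<lambda>v. s v - t v)"
  using affine.add[OF _ affine.scale[of t "-1"], of s] by simp

lemma presburger_less: "affine s \<Longrightarrow> affine t \<Longrightarrow> presburger (\<lambda>v. s v < t v)"
  using presburger.neg[OF presburger.le[of t s]] by (simp add: not_le)

lemma presburger_eq: "affine s \<Longrightarrow> affine t \<Longrightarrow> presburger (\<lambda>v. s v = t v)"
  using presburger.conj[OF presburger.le[of s t] presburger.le[of t s]]
  by (simp add: eq_iff)

lemma presburger_disj: "presburger P \<Longrightarrow> presburger Q \<Longrightarrow> presburger (\<lambda>v. P v \<or> Q v)"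
  using presburger.neg[OF presburger.conj[OF presburger.neg[of P] presburger.neg[of Q]]]
  by simp

lemma presburger_imp: "presburger P \<Longrightarrow> presburger Q \<Longrightarrow> presburger (\<lambda>v. P v \<longrightarrow> Q v)"
  using presburger_disj[OF presburger.neg[of P], of Q] by simp

lemma presburger_iff: "presburger P \<Longrightarrow> presburger Q \<Longrightarrow> presburger (\<lambda>v. P v \<longleftrightarrow> Q v)"
  using presburger.conj[OF presburger_imp[of P Q] presburger_imp[of Q P]]
  by (simp add: iff_conv_conj_imp)

lemma presburger_if:
  "presburger C \<Longrightarrow> presburger P \<Longrightarrow> presburger Q \<Longrightarrow> presburger (\<lambda>v. if C v then P v else Q v)"
  unfolding if_bool_eq_conj by (intro presburger.conj presburger_imp presburger.neg)

lemma presburger_const: "presburger (\<lambda>v. b)"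
proof -
  have "presburger (\<lambda>v. (if b then 0 else 1) \<le> (0 :: int))"
    by (intro presburger.le affine.const)
  then show ?thesis by (cases b) simp_all
qed

lemma presburger_abs_le:
  assumes "affine t"
  shows "presburger (\<lambda>v. \<bar>t v\<bar> \<le> c)"
  unfolding abs_le_iff
proof (rule presburger.conj)
  show "presburger (\<lambda>v. t v \<le> c)"
    by (intro presburger.le affine.const assms)
  show "presburger (\<lambda>v. - t v \<le> c)"
    using presburger.le[OF affine.scale[OF assms, of "-1"] affine.const[of c]] by simp
qed

lemma presburger_abs_eq:
  assumes "affine t"
  shows "presburger (\<lambda>v. \<bar>t v\<bar> = c)"
proof -
  have abs_eq: "x = c \<longleftrightarrow> x \<le> c \<and> \<not> x \<le> c - 1" for x :: int
    by auto
  show ?thesis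
    by (subst abs_eq) (intro presburger.conj presburger.neg presburger_abs_le assms)
qed

lemma presburger_Ball:
  assumes "finite I" and "\<And>i. i \<in> I \<Longrightarrow> presburger (P i)"
  shows "presburger (\<lambda>v. \<forall>i\<in>I. P i v)"
  using assms
proof (induction I rule: finite_induct)
  case empty
  then show ?case by (simp add: presburger_const)
next
  case (insert x I)
  then show ?case by (auto intro!: presburger.conj)
qed

lemma presburger_Bex:
  assumes "finite I" and "\<And>i. i \<in> I \<Longrightarrow> presburger (P i)"
  shows "presburger (\<lambda>v. \<exists>i\<in>I. P i v)"
  using presburger.neg[OF presburger_Ball[OF assms(1), of "\<lambda>i v. \<not> P i v"]] assms(2)
  by (simp add: presburger.neg)

lemma presburger_all_less:
  "(\<And>i. i < n \<Longrightarrow> presburger (P i)) \<Longrightarrow> presburger (\<lambda>v. \<forall>i<n. P i v)" for n :: nat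
  using presburger_Ball[of "{..<n}" P] by (simp add: Ball_def)

lemma presburger_ex_less:
  "(\<And>i. i < n \<Longrightarrow> presburger (P i)) \<Longrightarrow> presburger (\<lambda>v. \<exists>i<n. P i v)" for n :: nat
  using presburger_Bex[of "{..<n}" P] by (simp add: Bex_def)

lemmas presburger_intros =
  affine.intros affine_diff presburger.intros presburger_less presburger_eq presburger_disj
  presburger_imp presburger_iff presburger_if presburger_const
  presburger_all_less presburger_ex_less

text \<open>What the automaton for an inequality needs to know about a term: up to a constant it commutes
  with splitting off the last ternary digits, and on digits it is bounded.\<close>

lemma affine_decompose:
  assumes "affine t"
  shows "\<exists>h b S. (\<forall>v. t v = h v + b)
    \<and> (\<forall>d v. h (\<lambda>i j. d i j + 3 * v i j) = h d + 3 * h v)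
    \<and> (\<forall>d. (\<forall>i j. \<bar>d i j\<bar> \<le> 1) \<longrightarrow> \<bar>h d\<bar> \<le> S)"
  using assms
proof induction
  case (const c)
  show ?case
    by (rule exI[of _ "\<lambda>_. 0"], rule exI[of _ c], rule exI[of _ 0]) simp
next
  case (var i j)
  show ?case
    by (rule exI[of _ "\<lambda>v. v i j"], rule exI[of _ 0], rule exI[of _ 1]) simp
next
  case (add s t)
  obtain hs bs Ss where s: "\<forall>v. s v = hs v + bs"
    "\<forall>d v. hs (\<lambda>i j. d i j + 3 * v i j) = hs d + 3 * hs v"
    "\<forall>d. (\<forall>i j. \<bar>d i j\<bar> \<le> 1) \<longrightarrow> \<bar>hs d\<bar> \<le> Ss"
    using add.IH(1) by blast
  obtain ht bt St where t: "\<forall>v. t v = ht v + bt"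
    "\<forall>d v. ht (\<lambda>i j. d i j + 3 * v i j) = ht d + 3 * ht v"
    "\<forall>d. (\<forall>i j. \<bar>d i j\<bar> \<le> 1) \<longrightarrow> \<bar>ht d\<bar> \<le> St"
    using add.IH(2) by blast
  have "\<bar>hs d + ht d\<bar> \<le> Ss + St" if "\<forall>i j. \<bar>d i j\<bar> \<le> 1" for d
    using s(3) t(3) that by (meson abs_triangle_ineq add_mono order_trans)
  then show ?case
    using s(1,2) t(1,2)
    by (intro exI[of _ "\<lambda>v. hs v + ht v"] exI[of _ "bs + bt"] exI[of _ "Ss + St"])
      (auto simp: algebra_simps)
next
  case (scale t c)
  obtain h b S where t: "\<forall>v. t v = h v + b"
    "\<forall>d v. h (\<lambda>i j. d i j + 3 * v i j) = h d + 3 * h v"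
    "\<forall>d. (\<forall>i j. \<bar>d i j\<bar> \<le> 1) \<longrightarrow> \<bar>h d\<bar> \<le> S"
    using scale.IH by blast
  have "\<bar>c * h d\<bar> \<le> \<bar>c\<bar> * S" if "\<forall>i j. \<bar>d i j\<bar> \<le> 1" for d
    using t(3) that by (simp add: abs_mult mult_left_mono)
  then show ?case
    using t(1,2)
    by (intro exI[of _ "\<lambda>v. c * h v"] exI[of _ "c * b"] exI[of _ "\<bar>c\<bar> * S"])
      (auto simp: algebra_simps)
qed

section \<open>Convolutions\<close>

definition first_letter :: "'a list \<Rightarrow> 'a option" where
  "first_letter w = (case w of [] \<Rightarrow> None | a # _ \<Rightarrow> Some a)"

definition total_length :: "'a list list \<Rightarrow> nat" where
  "total_length ws = sum_list (map length ws)"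

lemma conv_words_empty: "\<forall>w\<in>set ws. w = [] \<Longrightarrow> conv_words ws = []"
proof -
  assume "\<forall>w\<in>set ws. w = []"
  then have lengths: "insert 0 (length ` set ws) = {0}" by auto
  show ?thesis unfolding conv_words_def lengths by simp
qed

text \<open>The definition of convolutions by indices hides this recursion, which lets properties of
  convolutions be proved by induction on the words (\<open>conv_words_induct\<close>). It holds because the
  greatest length drops by exactly one when every word loses its first letter.\<close>

lemma conv_words_step:
  assumes "\<exists>w\<in>set ws. w \<noteq> []"
  shows "conv_words ws = map first_letter ws # conv_words (map tl ws)"
proof -
  let ?N = "Max (insert 0 (length ` set ws))"
  let ?N' = "Max (insert 0 (length ` set (map tl ws)))"
  have N: "?N = Suc ?N'"
  proof (rule Max_eqI)
    fix y assume "y \<in> insert 0 (length ` set ws)"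
    then show "y \<le> Suc ?N'"
    proof
      assume "y \<in> length ` set ws"
      then obtain w where w: "w \<in> set ws" "y = length w" by blast
      then have "length (tl w) \<le> ?N'" by (intro Max_ge) (auto simp del: length_tl)
      then show ?thesis unfolding w(2) length_tl by linarith
    qed simp
  next
    have "?N' \<in> insert 0 (length ` set (map tl ws))" by (rule Max_in) auto
    then consider "?N' = 0" | w where "w \<in> set ws" "?N' = length (tl w)" "w \<noteq> []"
      by force
    then show "Suc ?N' \<in> insert 0 (length ` set ws)"
    proof cases
      case 1
      obtain w where w: "w \<in> set ws" "w \<noteq> []" using assms by blast
      then have "length (tl w) \<le> ?N'" by (intro Max_ge) (auto simp del: length_tl)
      then have "length w = Suc ?N'" using 1 w by (cases w) auto
      then show ?thesis using w by (metis image_eqI insertI2)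
    next
      case 2
      then have "Suc ?N' = length w" by simp
      then show ?thesis using 2 by blast
    qed
  qed simp
  show ?thesis
    unfolding conv_words_def N
    by (subst upt_conv_Cons, simp, subst map_Suc_upt[symmetric])
      (auto simp: first_letter_def nth_tl comp_def split: list.split)
qed

lemma total_length_tl_less:
  assumes "\<exists>w\<in>set ws. w \<noteq> []"
  shows "total_length (map tl ws) < total_length ws"
  using assms
proof (induction ws)
  case (Cons u ws)
  have "total_length (map tl ws) \<le> total_length ws"
    unfolding total_length_def by (simp add: sum_list_mono)
  then show ?case
    using Cons by (cases u) (auto simp: total_length_def)
qed simp

lemma conv_words_induct [case_names empty step]:
  assumes "\<And>ws. \<forall>w\<in>set ws. w = [] \<Longrightarrow> P ws"
    and "\<And>ws. \<exists>w\<in>set ws. w \<noteq> [] \<Longrightarrow> P (map tl ws) \<Longrightarrow> P ws"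
  shows "P ws"
proof (induction "total_length ws" arbitrary: ws rule: less_induct)
  case less
  then show ?case
    using assms total_length_tl_less by (cases "\<exists>w\<in>set ws. w \<noteq> []") blast+
qed

section \<open>Balanced ternary representation of integer vectors\<close>

definition digit_vectors :: "nat \<Rightarrow> (nat \<Rightarrow> int) set" where
  "digit_vectors m = {d. \<forall>j. (j \<in> {..<m} \<longrightarrow> d j \<in> {-1, 0, 1}) \<and> (j \<notin> {..<m} \<longrightarrow> d j = 0)}"

lemma finite_digit_vectors: "finite (digit_vectors m)"
  unfolding digit_vectors_def by (rule finite_set_of_finite_funs) auto

lemma digit_vectors_bound: "d \<in> digit_vectors m \<Longrightarrow> \<bar>d j\<bar> \<le> 1"
  by (cases "j < m") (auto simp: digit_vectors_def)

definition vectors :: "nat \<Rightarrow> (nat \<Rightarrow> int) set" where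
  "vectors m = {v. \<forall>j\<ge>m. v j = 0}"

text \<open>The valuation given by a tuple of vectors. Outside the tuple it is zero, which is also what
  a word over the product alphabet yields for tracks that it does not have.\<close>

definition tuple :: "(nat \<Rightarrow> int) list \<Rightarrow> nat \<Rightarrow> nat \<Rightarrow> int" where
  "tuple vs i = (if i < length vs then vs ! i else (\<lambda>_. 0))"

definition presburger_relation :: "nat \<Rightarrow> nat \<Rightarrow> (nat \<Rightarrow> int) list set \<Rightarrow> bool" where
  "presburger_relation m k R \<longleftrightarrow>
     (\<exists>P. presburger P \<and> R = {vs. length vs = k \<and> set vs \<subseteq> vectors m \<and> P (tuple vs)})"

text \<open>Letters are natural numbers, so a numbering of the digit vectors is fixed throughout.\<close>

locale ternary_alphabet =
  fixes m :: nat and \<Sigma> :: "nat set" and digits :: "nat \<Rightarrow> nat \<Rightarrow> int"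
  assumes finite_alphabet: "finite \<Sigma>"
    and digits_bij: "bij_betw digits \<Sigma> (digit_vectors m)"
begin

lemma digits_in: "a \<in> \<Sigma> \<Longrightarrow> digits a \<in> digit_vectors m"
  using digits_bij by (auto simp: bij_betw_def)

primrec word_value :: "nat list \<Rightarrow> nat \<Rightarrow> int" where
  "word_value [] = (\<lambda>j. 0)"
| "word_value (a # w) = (\<lambda>j. digits a j + 3 * word_value w j)"

text \<open>Trailing zero letters do not change the value; excluding them leaves one word for each vector.\<close>

definition trimmed :: "nat list set" where
  "trimmed = {w \<in> lists \<Sigma>. w \<noteq> [] \<longrightarrow> digits (last w) \<noteq> (\<lambda>_. 0)}"

lemma trimmed_Nil: "[] \<in> trimmed"
  by (simp add: trimmed_def)

lemma trimmed_Cons: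
  "a # w \<in> trimmed \<longleftrightarrow> a \<in> \<Sigma> \<and> w \<in> trimmed \<and> (w = [] \<longrightarrow> digits a \<noteq> (\<lambda>_. 0))"
  by (auto simp: trimmed_def)

lemma digit_eq_if_step_eq:
  fixes d e x y :: int
  assumes "d + 3 * x = e + 3 * y" and "\<bar>d\<bar> \<le> 1" and "\<bar>e\<bar> \<le> 1"
  shows "d = e \<and> x = y"
  using assms by presburger

text \<open>The last digits and the remaining quotients can be read off a sum, because balanced digits
  are determined by their residue modulo 3.\<close>

lemma word_value_step_eq:
  assumes "d \<in> digit_vectors m" and "e \<in> digit_vectors m"
    and "(\<lambda>j. d j + 3 * x j) = (\<lambda>j. e j + 3 * y j)"
  shows "d = e \<and> x = y"
  using digit_eq_if_step_eq[OF fun_cong[OF assms(3)] digit_vectors_bound[OF assms(1)]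
      digit_vectors_bound[OF assms(2)]]
  by auto

lemma zero_digit_vector: "(\<lambda>_. 0) \<in> digit_vectors m"
  by (simp add: digit_vectors_def)

lemma trimmed_value_zero: "w \<in> trimmed \<Longrightarrow> word_value w = (\<lambda>_. 0) \<Longrightarrow> w = []"
proof (induction w)
  case (Cons a w)
  have "(\<lambda>j. digits a j + 3 * word_value w j) = (\<lambda>j. 0 + 3 * 0)"
    using Cons.prems by simp
  then have "digits a = (\<lambda>_. 0) \<and> word_value w = (\<lambda>_. 0)"
    using Cons.prems digits_in zero_digit_vector
    by (intro word_value_step_eq) (auto simp: trimmed_Cons)
  then show ?case
    using Cons by (auto simp: trimmed_Cons)
qed simp

lemma word_value_inj: "inj_on word_value trimmed"
proof (rule inj_onI)
  fix w w' assume "w \<in> trimmed" "w' \<in> trimmed" "word_value w = word_value w'"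
  then show "w = w'"
  proof (induction w arbitrary: w')
    case Nil
    then show ?case using trimmed_value_zero[of w'] by simp
  next
    case (Cons a w)
    have "w' \<noteq> []"
      using Cons.prems trimmed_value_zero[of "a # w"] by auto
    then obtain b u where w': "w' = b # u" by (cases w') auto
    have same: "digits a = digits b \<and> word_value w = word_value u"
      using Cons.prems digits_in by (intro word_value_step_eq) (auto simp: trimmed_Cons w')
    have mem: "a \<in> \<Sigma>" "b \<in> \<Sigma>" "w \<in> trimmed" "u \<in> trimmed"
      using Cons.prems by (auto simp: trimmed_Cons w')
    have "a = b"
      using same mem(1,2) digits_bij by (meson bij_betw_def inj_onD)
    moreover have "w = u"
      using same mem(3,4) Cons.IH by blast
    ultimately show ?case by (simp add: w')
  qed
qed

lemma word_value_vectors: "w \<in> trimmed \<Longrightarrow> word_value w \<in> vectors m"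
proof (induction w)
  case (Cons a w)
  then have "digits a \<in> digit_vectors m" by (auto simp: trimmed_Cons digits_in)
  then show ?case
    using Cons by (auto simp: trimmed_Cons vectors_def digit_vectors_def)
qed (simp add: vectors_def)

text \<open>Existence of balanced ternary expansions. Rounding \<open>v j / 3\<close> to the nearest integer
  decreases the absolute value of every nonzero entry, which is the termination measure.\<close>

lemma word_value_surj:
  assumes "v \<in> vectors m"
  shows "v \<in> word_value ` trimmed"
  using assms
proof (induction "\<Sum>j<m. nat \<bar>v j\<bar>" arbitrary: v rule: less_induct)
  case less
  show ?case
  proof (cases "v = (\<lambda>_. 0)")
    case True
    then show ?thesis
      by (intro image_eqI[of _ _ "[]"]) (simp_all add: trimmed_Nil)
  next
    case False
    define d where "d = (\<lambda>j. (v j + 1) mod 3 - 1)"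
    define v' where "v' = (\<lambda>j. (v j + 1) div 3)"
    have v: "v = (\<lambda>j. d j + 3 * v' j)"
    proof
      fix j
      show "v j = d j + 3 * v' j" unfolding d_def v'_def by presburger
    qed
    have v'_vec: "v' \<in> vectors m"
      using less.prems by (simp add: vectors_def v'_def)
    have "d j \<in> {-1, 0, 1}" for j
    proof -
      have "(v j + 1) mod 3 \<in> {0, 1, 2}" by auto
      then show ?thesis by (auto simp: d_def)
    qed
    then have "d \<in> digit_vectors m"
      using less.prems by (auto simp: digit_vectors_def vectors_def d_def)
    then obtain a where a: "a \<in> \<Sigma>" "digits a = d"
      using digits_bij by (metis bij_betw_def imageE)
    have shrink: "nat \<bar>(x + 1) div 3\<bar> \<le> nat \<bar>x\<bar>" "x \<noteq> 0 \<Longrightarrow> nat \<bar>(x + 1) div 3\<bar> < nat \<bar>x\<bar>"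
      for x :: int by linarith+
    obtain j where "v j \<noteq> 0" using False by auto
    then have "j < m" using less.prems by (simp add: vectors_def) (meson leI)
    then have "(\<Sum>j<m. nat \<bar>v' j\<bar>) < (\<Sum>j<m. nat \<bar>v j\<bar>)"
      using \<open>v j \<noteq> 0\<close> shrink unfolding v'_def by (intro sum_strict_mono_ex1) auto
    then obtain w where w: "w \<in> trimmed" "v' = word_value w"
      using less.hyps v'_vec by blast
    have "w = [] \<longrightarrow> digits a \<noteq> (\<lambda>_. 0)"
      using False v w a by auto
    then have "a # w \<in> trimmed" using a w by (simp add: trimmed_Cons)
    moreover have "v = word_value (a # w)" using v a w by simp
    ultimately show ?thesis by blast
  qed
qed

definition word_of :: "(nat \<Rightarrow> int) \<Rightarrow> nat list" where
  "word_of = inv_into trimmed word_value"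

lemma word_of_trimmed: "v \<in> vectors m \<Longrightarrow> word_of v \<in> trimmed"
  unfolding word_of_def by (rule inv_into_into) (rule word_value_surj)

lemma word_value_word_of: "v \<in> vectors m \<Longrightarrow> word_value (word_of v) = v"
  unfolding word_of_def by (rule f_inv_into_f) (rule word_value_surj)

lemma word_of_word_value: "w \<in> trimmed \<Longrightarrow> word_of (word_value w) = w"
  unfolding word_of_def by (rule inv_into_f_f[OF word_value_inj])

definition column_digits :: "nat option list \<Rightarrow> nat \<Rightarrow> nat \<Rightarrow> int" where
  "column_digits c i =
     (if i < length c then (case c ! i of None \<Rightarrow> (\<lambda>_. 0) | Some a \<Rightarrow> digits a) else (\<lambda>_. 0))"

text \<open>The valuation that a word over the product alphabet encodes; padding counts as zero digits.\<close>

primrec columns_value :: "nat option list list \<Rightarrow> nat \<Rightarrow> nat \<Rightarrow> int" where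
  "columns_value [] = (\<lambda>i j. 0)"
| "columns_value (c # cs) = (\<lambda>i j. column_digits c i j + 3 * columns_value cs i j)"

lemma columns_value_conv_words: "columns_value (conv_words ws) = tuple (map word_value ws)"
proof (induction ws rule: conv_words_induct)
  case (empty ws)
  then have "word_value (ws ! i) = (\<lambda>_. 0)" if "i < length ws" for i
    using that by (metis nth_mem word_value.simps(1))
  then have "tuple (map word_value ws) = (\<lambda>i j. 0)"
    by (simp add: tuple_def fun_eq_iff)
  then show ?case using empty by (simp add: conv_words_empty)
next
  case (step ws)
  have "column_digits (map first_letter ws) i j + 3 * tuple (map word_value (map tl ws)) i j
      = tuple (map word_value ws) i j" for i j
    by (cases "i < length ws"; cases "ws ! i")
      (auto simp: column_digits_def tuple_def first_letter_def)
  then show ?case using step by (simp add: conv_words_step)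
qed

lemma column_digits_bound:
  assumes "c \<in> product_alphabet \<Sigma> k"
  shows "\<bar>column_digits c i j\<bar> \<le> 1"
proof -
  have "c ! i \<in> insert None (Some ` \<Sigma>)" if "i < length c"
    using assms that unfolding product_alphabet_def by (metis (mono_tags) mem_Collect_eq nth_mem subsetD)
  then show ?thesis
    using digit_vectors_bound[OF digits_in] by (auto simp: column_digits_def)
qed

text \<open>A half-space is mapped to a parallel half-space by removing the first column, and all bounds
  that occur stay in an interval \<open>{-B..B}\<close>, since one step divides the bound by 3.\<close>

lemma finite_residuals_le:
  assumes "affine s" and "affine t"
  shows "finite_residuals (product_alphabet \<Sigma> k) {w. s (columns_value w) \<le> t (columns_value w)}"
proof -
  obtain h b S where h: "\<And>v. s v - t v = h v + b"
    "\<And>d v. h (\<lambda>i j. d i j + 3 * v i j) = h d + 3 * h v"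
    "\<And>d. (\<forall>i j. \<bar>d i j\<bar> \<le> 1) \<Longrightarrow> \<bar>h d\<bar> \<le> S"
    using affine_decompose[OF affine_diff[OF assms]] by blast
  define half_space where "half_space c = {w. h (columns_value w) \<le> c}" for c
  \<comment> \<open>Any \<open>B\<close> with \<open>B + S + 2 \<le> 3 * B\<close> is preserved by a step.\<close>
  define B where "B = \<bar>b\<bar> + \<bar>S\<bar> + 1"
  have "residual [c] (half_space x) = half_space ((x - h (column_digits c)) div 3)" for c x
    by (auto simp: residual_def half_space_def h(2))
  moreover have "(x - h (column_digits c)) div 3 \<in> {-B..B}"
    if "x \<in> {-B..B}" "c \<in> product_alphabet \<Sigma> k" for c x
  proof -
    have "\<bar>h (column_digits c)\<bar> \<le> S"
      using h(3) column_digits_bound[OF that(2)] by blast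
    then show ?thesis using that(1) unfolding B_def by auto
  qed
  moreover have "- b \<in> {-B..B}" unfolding B_def by auto
  ultimately have "finite_residuals (product_alphabet \<Sigma> k) (half_space (- b))"
    by (intro finite_residualsI[of "half_space ` {-B..B}"]) auto
  moreover have "half_space (- b) = {w. s (columns_value w) \<le> t (columns_value w)}"
  proof -
    have "h v \<le> - b \<longleftrightarrow> s v \<le> t v" for v
      using h(1)[of v] by linarith
    then show ?thesis by (simp add: half_space_def)
  qed
  ultimately show ?thesis by simp
qed

lemma finite_residuals_presburger:
  assumes "presburger P"
  shows "finite_residuals (product_alphabet \<Sigma> k) {w. P (columns_value w)}"
  using assms
proof induction
  case (le s t)
  then show ?case by (rule finite_residuals_le)
next
  case (neg P)
  then show ?case
    using finite_residuals_Compl by (auto simp: Collect_neg_eq)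
next
  case (conj P Q)
  then show ?case
    using finite_residuals_Int by (auto simp: Collect_conj_eq)
qed

text \<open>Two adjacent columns of a convolution of trimmed words are compatible on each track if
  padding continues and if a word does not end in a zero letter.\<close>

definition may_follow :: "nat option list \<Rightarrow> nat option list \<Rightarrow> bool" where
  "may_follow c c' \<longleftrightarrow> (\<forall>i < length c.
     (c ! i = None \<longrightarrow> c' ! i = None) \<and>
     (c' ! i = None \<longrightarrow> column_digits c i = (\<lambda>_. 0) \<longrightarrow> c ! i = None))"

text \<open>After the end of the word every track is padded. With this convention the condition on the
  last letters of the words that reach the final column is an instance of
  \<^const>\<open>may_follow\<close>.\<close>

definition next_column :: "nat \<Rightarrow> nat option list list \<Rightarrow> nat option list" where
  "next_column k w = (case w of [] \<Rightarrow> replicate k None | c # _ \<Rightarrow> c)"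

text \<open>Which words over the product alphabet are convolutions of trimmed words. A column consisting of
  padding only does not occur, since a convolution is as long as its longest word.\<close>

primrec proper :: "nat \<Rightarrow> nat option list list \<Rightarrow> bool" where
  "proper k [] = True"
| "proper k (c # w) \<longleftrightarrow>
     c \<noteq> replicate k None \<and> may_follow c (next_column k w) \<and> proper k w"

lemma finite_product_alphabet: "finite (product_alphabet \<Sigma> k)"
proof -
  have "product_alphabet \<Sigma> k = {c. set c \<subseteq> insert None (Some ` \<Sigma>) \<and> length c = k}"
    by (auto simp: product_alphabet_def)
  then show ?thesis
    using finite_alphabet by (simp add: finite_lists_length_eq)
qed

text \<open>Once a column has been read, the rest of the word is constrained only by that column, so
  the columns index the residuals.\<close>

lemma finite_residuals_proper:
  "finite_residuals (product_alphabet \<Sigma> k) {w. proper k w}"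
proof -
  let ?after = "\<lambda>c. {w. may_follow c (next_column k w) \<and> proper k w}"
  have "residual [c] {w. proper k w} = (if c = replicate k None then {} else ?after c)"
    "residual [c] (?after b)
      = (if may_follow b c \<and> c \<noteq> replicate k None then ?after c else {})" 
    "residual [c] {} = {}" for c b
    by (auto simp: residual_def next_column_def)
  note residuals = this
  show ?thesis
  proof (rule finite_residualsI)
    fix K c assume "K \<in> {{}, {w. proper k w}} \<union> ?after ` product_alphabet \<Sigma> k"
      and c: "c \<in> product_alphabet \<Sigma> k"
    then consider "K = {}" | "K = {w. proper k w}" | b where "K = ?after b" by blast
    then show "residual [c] K \<in> {{}, {w. proper k w}} \<union> ?after ` product_alphabet \<Sigma> k"
      using c by cases (simp_all only: residuals split: if_split, blast+)
  qed (use finite_product_alphabet in auto)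
qed

lemma first_letter_None: "first_letter w = None \<longleftrightarrow> w = []"
  by (cases w) (auto simp: first_letter_def)

lemma next_column_conv_words:
  "next_column (length ws) (conv_words ws) = map first_letter ws"
proof (cases "\<exists>w\<in>set ws. w \<noteq> []")
  case True
  then show ?thesis by (simp add: conv_words_step next_column_def)
next
  case False
  then have "map first_letter ws = replicate (length ws) None"
    by (simp add: map_replicate_const[symmetric] first_letter_None)
  then show ?thesis
    using False by (simp add: conv_words_empty next_column_def)
qed

lemma proper_conv_words:
  "set ws \<subseteq> trimmed \<Longrightarrow>
    conv_words ws \<in> lists (product_alphabet \<Sigma> (length ws)) \<and> proper (length ws) (conv_words ws)"
proof (induction ws rule: conv_words_induct)
  case (empty ws)
  then show ?case by (simp add: conv_words_empty)
next
  case (step ws)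
  have "tl w \<in> trimmed" if "w \<in> set ws" for w
    using subsetD[OF step.prems that] by (cases w) (auto simp: trimmed_Cons trimmed_Nil)
  then have IH: "conv_words (map tl ws) \<in> lists (product_alphabet \<Sigma> (length ws))"
    "proper (length ws) (conv_words (map tl ws))"
    using step.IH by auto
  have "first_letter w \<in> insert None (Some ` \<Sigma>)" if "w \<in> set ws" for w
    using subsetD[OF step.prems that] by (cases w) (auto simp: first_letter_def trimmed_Cons)
  then have "map first_letter ws \<in> product_alphabet \<Sigma> (length ws)"
    by (auto simp: product_alphabet_def)
  moreover have "map first_letter ws \<noteq> replicate (length ws) None"
    using step.hyps first_letter_None by (metis in_set_replicate image_eqI set_map)
  moreover have "may_follow (map first_letter ws) (map first_letter (map tl ws))"
    unfolding may_follow_def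
  proof (intro allI impI)
    fix i assume "i < length (map first_letter ws)"
    then have "i < length ws" "ws ! i \<in> trimmed" using step.prems by auto
    then show "(map first_letter ws ! i = None \<longrightarrow> map first_letter (map tl ws) ! i = None) \<and>
      (map first_letter (map tl ws) ! i = None \<longrightarrow>
        column_digits (map first_letter ws) i = (\<lambda>_. 0) \<longrightarrow> map first_letter ws ! i = None)"
      by (cases "ws ! i")
        (auto simp: first_letter_None trimmed_Cons column_digits_def first_letter_def
          split: list.splits)
  qed
  ultimately show ?case
    using IH step.hyps next_column_conv_words[of "map tl ws"] by (simp add: conv_words_step)
qed

lemma proper_is_conv_words:
  "w \<in> lists (product_alphabet \<Sigma> k) \<Longrightarrow> proper k w \<Longrightarrow>
    \<exists>ws. length ws = k \<and> set ws \<subseteq> trimmed \<and> conv_words ws = w"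
proof (induction w)
  case Nil
  then show ?case
    by (intro exI[of _ "replicate k []"]) (auto simp: conv_words_empty trimmed_Nil)
next
  case (Cons c w)
  then obtain ws where ws: "length ws = k" "set ws \<subseteq> trimmed" "conv_words ws = w"
    by auto
  have c: "length c = k" "set c \<subseteq> insert None (Some ` \<Sigma>)"
    using Cons.prems by (auto simp: product_alphabet_def)
  have follow: "may_follow c (map first_letter ws)" and c_nonempty: "c \<noteq> replicate k None"
    using Cons.prems(2) next_column_conv_words[of ws] ws by simp_all
  define extend where
    "extend i = (case c ! i of None \<Rightarrow> [] | Some a \<Rightarrow> a # ws ! i)" for i
  have i: "extend i \<in> trimmed \<and> first_letter (extend i) = c ! i \<and> tl (extend i) = ws ! i"
    if "i < k" for i
  proof (cases "c ! i")
    case None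
    then have "ws ! i = []"
      using follow that c(1) ws(1) by (auto simp: may_follow_def first_letter_None)
    then show ?thesis
      using None by (simp add: extend_def trimmed_Nil first_letter_def)
  next
    case (Some a)
    then have "a \<in> \<Sigma>" using c that by (metis imageE insertE nth_mem option.distinct(1) option.inject subsetD)
    moreover have "ws ! i = [] \<longrightarrow> digits a \<noteq> (\<lambda>_. 0)"
      using follow that c(1) ws(1) Some
      by (auto simp: may_follow_def first_letter_None column_digits_def)
    ultimately show ?thesis
      using Some ws that by (auto simp: extend_def trimmed_Cons first_letter_def)
  qed
  let ?us = "map extend [0..<k]"
  have letters: "map first_letter ?us = c" and tails: "map tl ?us = ws"
    using i c(1) ws(1) by (auto intro!: nth_equalityI)
  have "\<exists>u\<in>set ?us. u \<noteq> []"
  proof (rule ccontr)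
    assume "\<not> ?thesis"
    then have "map first_letter ?us = replicate k None"
      by (auto intro!: nth_equalityI simp: first_letter_def)
    then show False using letters c_nonempty by simp
  qed
  then have "conv_words ?us = c # w"
    using conv_words_step[of ?us] letters tails ws(3) by simp
  moreover have "set ?us \<subseteq> trimmed" using i by auto
  ultimately show ?case by (intro exI[of _ ?us]) simp
qed

text \<open>A word belongs to the encoded relation if it is a convolution of trimmed words and the vectors
  that it encodes satisfy the predicate; both conditions have finitely many residuals.\<close>

lemma regular_relation_if_presburger_relation:
  assumes "presburger_relation m k (map enc ` R)"
  shows "regular_relation \<Sigma> k (map (word_of \<circ> enc) ` R)"
proof -
  obtain P where P: "presburger P"
    and R: "map enc ` R = {vs. length vs = k \<and> set vs \<subseteq> vectors m \<and> P (tuple vs)}"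
    using assms by (auto simp: presburger_relation_def)
  have xs: "length xs = k" "set (map enc xs) \<subseteq> vectors m" "P (tuple (map enc xs))"
    if "xs \<in> R" for xs
  proof -
    have "map enc xs \<in> {vs. length vs = k \<and> set vs \<subseteq> vectors m \<and> P (tuple vs)}"
      using that R by blast
    then show "length xs = k" "set (map enc xs) \<subseteq> vectors m" "P (tuple (map enc xs))"
      by simp_all
  qed
  have words: "set (map (word_of \<circ> enc) xs) \<subseteq> trimmed" if "xs \<in> R" for xs
    using xs(2)[OF that] word_of_trimmed by auto
  have "conv_words ` map (word_of \<circ> enc) ` R =
    {w \<in> lists (product_alphabet \<Sigma> k). w \<in> {w. proper k w} \<inter> {w. P (columns_value w)}}"
    (is "?L = ?R")
  proof
    show "?L \<subseteq> ?R"
    proof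
      fix w assume "w \<in> ?L"
      then obtain xs where "xs \<in> R" and w: "w = conv_words (map (word_of \<circ> enc) xs)" by blast
      have decoded: "map word_value (map (word_of \<circ> enc) xs) = map enc xs"
        using xs(2)[OF \<open>xs \<in> R\<close>] word_value_word_of by auto
      then show "w \<in> ?R"
        using xs[OF \<open>xs \<in> R\<close>] proper_conv_words[OF words[OF \<open>xs \<in> R\<close>]]
        by (simp add: w columns_value_conv_words decoded del: map_map)
    qed
    show "?R \<subseteq> ?L"
    proof
      fix w assume w: "w \<in> ?R"
      then obtain ws where ws: "length ws = k" "set ws \<subseteq> trimmed" "conv_words ws = w"
        using proper_is_conv_words by blast
      have "P (tuple (map word_value ws))"
        using w ws columns_value_conv_words[of ws] by simp
      then have "map word_value ws \<in> map enc ` R"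
        unfolding R using ws word_value_vectors by auto
      then obtain xs where "xs \<in> R" and "map word_value ws = map enc xs" by blast
      moreover have "map (word_of \<circ> word_value) ws = ws"
        using ws(2) word_of_word_value by (intro map_idI) auto
      ultimately have "ws = map (word_of \<circ> enc) xs" by (metis map_map)
      then show "w \<in> ?L" using ws(3) \<open>xs \<in> R\<close> by blast
    qed
  qed
  moreover have "regular_language (product_alphabet \<Sigma> k)
    {w \<in> lists (product_alphabet \<Sigma> k). w \<in> {w. proper k w} \<inter> {w. P (columns_value w)}}"
    by (intro regular_language_if_finite_residuals finite_product_alphabet finite_residuals_Int
        finite_residuals_proper finite_residuals_presburger P)
  moreover have "map (word_of \<circ> enc) ` R \<subseteq> {ws. length ws = k \<and> set ws \<subseteq> lists \<Sigma>}"
    using xs(1) words by (force simp: trimmed_def)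
  ultimately show ?thesis by (simp add: regular_relation_def)
qed

end

lemma conv_words_singleton: "conv_words [w] = map (\<lambda>a. [Some a]) w"
  by (induction w) (simp_all add: conv_words_empty conv_words_step first_letter_def)

text \<open>The domain has to be regular as a set of words rather than as a unary relation; a word and its
  convolution differ only in the wrapping of letters.\<close>

lemma regular_language_if_unary_relation:
  assumes "regular_relation \<Sigma> 1 ((\<lambda>w. [w]) ` W)" and "finite \<Sigma>"
  shows "regular_language \<Sigma> W"
proof -
  let ?h = "map (\<lambda>a. [Some a])"
  have W: "W \<subseteq> lists \<Sigma>"
    using assms(1) unfolding regular_relation_def by fastforce
  have "conv_words ` (\<lambda>w. [w]) ` W = ?h ` W"
    by (simp add: image_image conv_words_singleton)
  then obtain M where M: "wf_dfa (product_alphabet \<Sigma> 1) M"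
    and L: "?h ` W = dfa_language (product_alphabet \<Sigma> 1) M"
    using assms(1) by (auto simp: regular_relation_def regular_language_def)
  let ?M = "\<lparr>dfa_states = dfa_states M, dfa_init = dfa_init M,
    dfa_next = (\<lambda>s a. dfa_next M s [Some a]), dfa_final = dfa_final M\<rparr>"
  have letter: "[Some a] \<in> product_alphabet \<Sigma> 1" if "a \<in> \<Sigma>" for a
    using that by (simp add: product_alphabet_def)
  have "inj ?h" by (simp add: inj_def)
  have "w \<in> W \<longleftrightarrow> w \<in> dfa_language \<Sigma> ?M" for w
  proof (cases "w \<in> lists \<Sigma>")
    case True
    then have "?h w \<in> lists (product_alphabet \<Sigma> 1)" using letter by auto
    moreover have "w \<in> W \<longleftrightarrow> ?h w \<in> ?h ` W"
      using inj_image_mem_iff[OF \<open>inj ?h\<close>] by blast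
    ultimately show ?thesis
      using True by (simp add: L dfa_language_def foldl_map)
  qed (use W in \<open>auto simp: dfa_language_def\<close>)
  moreover have "wf_dfa \<Sigma> ?M"
    using M letter by (auto simp: wf_dfa_def)
  ultimately show ?thesis
    using \<open>finite \<Sigma>\<close> unfolding regular_language_def by blast
qed

theorem automatic_if_presburger:
  fixes enc :: "'a \<Rightarrow> nat \<Rightarrow> int"
  assumes inj: "inj_on enc (universe S)"
    and universe: "presburger_relation m 1 ((\<lambda>x. [enc x]) ` universe S)"
    and relations: "\<And>k R. (k, R) \<in> set (relations S) \<Longrightarrow> presburger_relation m k (map enc ` R)"
  shows "automatic S"
proof -
  obtain digits where "bij_betw digits {0..<card (digit_vectors m)} (digit_vectors m)"
    using ex_bij_betw_nat_finite[OF finite_digit_vectors] by blast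
  then interpret ternary_alphabet m "{0..<card (digit_vectors m)}" digits
    by unfold_locales auto
  let ?\<Sigma> = "{0..<card (digit_vectors m)}"
  have "presburger_relation m 1 (map enc ` (\<lambda>x. [x]) ` universe S)"
    using universe by (simp add: image_image)
  then have "regular_relation ?\<Sigma> 1 ((\<lambda>w. [w]) ` (word_of \<circ> enc) ` universe S)"
    using regular_relation_if_presburger_relation by (fastforce simp: image_image)
  then have "regular_language ?\<Sigma> ((word_of \<circ> enc) ` universe S)"
    using regular_language_if_unary_relation by blast
  moreover have "enc x \<in> vectors m" if "x \<in> universe S" for x
  proof -
    obtain P where "(\<lambda>x. [enc x]) ` universe S
        = {vs. length vs = 1 \<and> set vs \<subseteq> vectors m \<and> P (tuple vs)}"
      using universe unfolding presburger_relation_def by blast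
    then have "[enc x] \<in> {vs. length vs = 1 \<and> set vs \<subseteq> vectors m \<and> P (tuple vs)}"
      using that by blast
    then show ?thesis by simp
  qed
  then have "inj_on (word_of \<circ> enc) (universe S)"
    using inj by (intro inj_onI) (metis comp_apply inj_onD word_value_word_of)
  moreover have "\<forall>(k, R) \<in> set (relations S). regular_relation ?\<Sigma> k (map (word_of \<circ> enc) ` R)"
    using relations regular_relation_if_presburger_relation by blast
  ultimately show ?thesis
    unfolding automatic_def by blast
qed

section \<open>Chess in Presburger arithmetic\<close>

text \<open>Definitions about positions are transported along a decoding function that is defined on all
  vectors. Predicates of decoded positions then become formulas by mere unfolding, with
  quantifiers over pieces turned into quantifiers over indices below \<open>length A\<close>.\<close>

definition decode_piece :: "piece_type list \<Rightarrow> (nat \<Rightarrow> int) \<Rightarrow> nat \<Rightarrow> piece" where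
  "decode_piece A v j =
     \<lparr>ptype = A ! j, live = (v (3 * j) = 1), loc = (v (3 * j + 1), v (3 * j + 2))\<rparr>"

definition decode :: "piece_type list \<Rightarrow> (nat \<Rightarrow> int) \<Rightarrow> position" where
  "decode A v =
     \<lparr>pieces = map (decode_piece A v) [0..<length A],
      turn = (if v (3 * length A) = 0 then White else Black)\<rparr>"

definition encode :: "position \<Rightarrow> nat \<Rightarrow> int" where
  "encode p i =
     (let n = length (pieces p); a = pieces p ! (i div 3) in
      if i < 3 * n then
        (if i mod 3 = 0 then (if live a then 1 else 0)
         else if i mod 3 = 1 then fst (loc a) else snd (loc a))
      else if i = 3 * n then (if turn p = White then 0 else 1)
      else 0)"

lemma decode_piece_simps [simp]:
  "ptype (decode_piece A v j) = A ! j"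
  "live (decode_piece A v j) \<longleftrightarrow> v (3 * j) = 1"
  "loc (decode_piece A v j) = (v (3 * j + 1), v (3 * j + 2))"
  by (simp_all add: decode_piece_def)

lemma decode_simps:
  "length (pieces (decode A v)) = length A"
  "j < length A \<Longrightarrow> pieces (decode A v) ! j = decode_piece A v j"
  "turn (decode A v) = (if v (3 * length A) = 0 then White else Black)"
  "map ptype (pieces (decode A v)) = A"
  by (auto simp: decode_def intro!: nth_equalityI)

lemma Bex_pieces_decode:
  "(\<exists>a\<in>set (pieces (decode A v)). P a) \<longleftrightarrow> (\<exists>j<length A. P (decode_piece A v j))"
  by (auto simp: decode_def)

lemma Ball_pieces_decode:
  "(\<forall>a\<in>set (pieces (decode A v)). P a) \<longleftrightarrow> (\<forall>j<length A. P (decode_piece A v j))"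
  by (auto simp: decode_def)

lemma encode_simps:
  assumes "j < length (pieces p)"
  shows "encode p (3 * j) = (if live (pieces p ! j) then 1 else 0)"
    and "encode p (3 * j + 1) = fst (loc (pieces p ! j))"
    and "encode p (3 * j + 2) = snd (loc (pieces p ! j))"
proof -
  have "3 * j div 3 = j" "(3 * j + 1) div 3 = j" "(3 * j + 2) div 3 = j"
    "3 * j mod 3 = 0" "(3 * j + 1) mod 3 = 1" "(3 * j + 2) mod 3 = 2"
    by presburger+
  note arith = this
  show "encode p (3 * j) = (if live (pieces p ! j) then 1 else 0)"
    "encode p (3 * j + 1) = fst (loc (pieces p ! j))"
    "encode p (3 * j + 2) = snd (loc (pieces p ! j))"
    unfolding encode_def Let_def arith using assms by simp_all
qed

lemma decode_encode:
  assumes "map ptype (pieces p) = A"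
  shows "decode A (encode p) = p"
proof -
  have n: "length A = length (pieces p)" using assms by auto
  have "decode_piece A (encode p) j = pieces p ! j" if "j < length A" for j
    using that n nth_map[of j "pieces p" ptype] assms
    unfolding decode_piece_def by (simp only: encode_simps) (simp add: piece.equality)
  then have "pieces (decode A (encode p)) = pieces p"
    using n by (auto simp: decode_simps intro!: nth_equalityI)
  moreover have "turn (decode A (encode p)) = turn p"
    using n by (cases "turn p") (simp_all add: decode_simps encode_def)
  ultimately show ?thesis by simp
qed

text \<open>Decoding ignores the difference between various values that mean ``captured'' or ``black to
  play''; normal vectors use 0 and 1, so that a position has a single code.\<close>

definition normal_vector :: "piece_type list \<Rightarrow> (nat \<Rightarrow> int) \<Rightarrow> bool" where
  "normal_vector A v \<longleftrightarrow>
     (\<forall>j<length A. v (3 * j) = 0 \<or> v (3 * j) = 1) \<and> (v (3 * length A) = 0 \<or> v (3 * length A) = 1)"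

lemma encode_normal:
  assumes "map ptype (pieces p) = A"
  shows "normal_vector A (encode p)" and "encode p \<in> vectors (3 * length A + 1)"
  using assms by (auto simp: normal_vector_def vectors_def encode_def)

lemma encode_decode:
  assumes "v \<in> vectors (3 * length A + 1)" and "normal_vector A v"
  shows "encode (decode A v) = v"
proof
  fix i
  consider "i < 3 * length A" | "i = 3 * length A" | "i > 3 * length A" by linarith
  then show "encode (decode A v) i = v i"
  proof cases
    case 1
    define j where "j = i div 3"
    have j: "j < length A" using 1 by (auto simp: j_def)
    consider "i = 3 * j" | "i = 3 * j + 1" | "i = 3 * j + 2" unfolding j_def by linarith
    then show ?thesis
      using j assms(2) encode_simps[of j "decode A v"]
      by cases (auto simp: decode_simps normal_vector_def)
  next
    case 2
    then show ?thesis
      using assms(2) by (auto simp: encode_def decode_simps normal_vector_def)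
  next
    case 3
    then show ?thesis
      using assms(1) by (auto simp: encode_def decode_simps vectors_def)
  qed
qed

lemma presburger_occupied:
  assumes "affine x" "affine y"
  shows "presburger (\<lambda>v. occupied (decode A (v i)) (x v, y v))"
  unfolding occupied_def Bex_pieces_decode decode_piece_simps prod.inject
  by (intro presburger_intros assms)

lemma presburger_occupied_by:
  assumes "affine x" "affine y"
  shows "presburger (\<lambda>v. occupied_by c (decode A (v i)) (x v, y v))"
  unfolding occupied_by_def Bex_pieces_decode decode_piece_simps prod.inject
  by (intro presburger_intros assms)

definition slides_along :: "int \<times> int \<Rightarrow> position \<Rightarrow> square \<Rightarrow> square \<Rightarrow> bool" where
  "slides_along d p s t \<longleftrightarrow>
     (\<exists>n > 0. t = (fst s + n * fst d, snd s + n * snd d) \<and>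
        (\<forall>m. 0 < m \<and> m < n \<longrightarrow> \<not> occupied p (fst s + m * fst d, snd s + m * snd d)))"

lemma slides_iff: "slides D p s t \<longleftrightarrow> (\<exists>d\<in>D. slides_along d p s t)"
  by (simp add: slides_def slides_along_def case_prod_beta)

text \<open>Elimination of the number of steps: on the line through \<open>(sx, sy)\<close> with direction
  \<open>(dx, dy)\<close>, a functional \<open>(ex, ey)\<close> with value 1 on the direction computes
  the number of steps to a square from its coordinates. The steps to the target and to every potential obstacle
  become linear terms.\<close>

lemma slides_along_linear:
  fixes dx dy ex ey sx sy tx ty :: int
  assumes unit: "ex * dx + ey * dy = 1"
  defines "steps \<equiv> \<lambda>x y. ex * (x - sx) + ey * (y - sy)"
  shows "slides_along (dx, dy) p (sx, sy) (tx, ty) \<longleftrightarrow>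
    0 < steps tx ty \<and> tx = sx + dx * steps tx ty \<and> ty = sy + dy * steps tx ty \<and>
    (\<forall>a\<in>set (pieces p). live a \<longrightarrow>
      \<not> (0 < steps (fst (loc a)) (snd (loc a)) \<and>
         steps (fst (loc a)) (snd (loc a)) < steps tx ty \<and>
         fst (loc a) = sx + dx * steps (fst (loc a)) (snd (loc a)) \<and>
         snd (loc a) = sy + dy * steps (fst (loc a)) (snd (loc a))))"
proof -
  have on_ray: "x = sx + m * dx \<and> y = sy + m * dy \<longleftrightarrow>
      m = steps x y \<and> x = sx + dx * steps x y \<and> y = sy + dy * steps x y" for m x y
  proof -
    have "steps (sx + m * dx) (sy + m * dy) = m"
      using arg_cong[OF unit, of "\<lambda>u. m * u"] by (simp add: steps_def algebra_simps)
    then show ?thesis by (auto simp: mult.commute)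
  qed
  show ?thesis
    unfolding slides_along_def occupied_def fst_conv snd_conv prod_eq_iff on_ray by blast
qed

lemma presburger_slides:
  assumes D: "D \<subseteq> straight_dirs \<union> diagonal_dirs" and "affine sx" "affine sy" "affine tx" "affine ty"
  shows "presburger (\<lambda>v. slides D (decode A (v i)) (sx v, sy v) (tx v, ty v))"
  unfolding slides_iff
proof (rule presburger_Bex)
  have "finite (straight_dirs \<union> diagonal_dirs)"
    by (simp add: straight_dirs_def diagonal_dirs_def)
  then show "finite D" using D finite_subset by blast
next
  fix d assume "d \<in> D"
  \<comment> \<open>All entries of a direction are 0 or \<open>\<plusminus>1\<close>, so projecting to a nonzero one
    (up to its sign) counts the steps.\<close>
  then obtain dx dy ex ey where d: "d = (dx, dy)" and unit: "ex * dx + ey * dy = (1 :: int)"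
  proof -
    have "fst d * fst d + 0 * snd d = 1 \<or> 0 * fst d + snd d * snd d = 1"
      using \<open>d \<in> D\<close> D by (auto simp: straight_dirs_def diagonal_dirs_def)
    then show ?thesis using that[of "fst d" "snd d" "fst d" 0] that[of "fst d" "snd d" 0 "snd d"] by auto
  qed
  have "presburger (\<lambda>v.
      0 < ex * (tx v - sx v) + ey * (ty v - sy v) \<and>
      tx v = sx v + dx * (ex * (tx v - sx v) + ey * (ty v - sy v)) \<and>
      ty v = sy v + dy * (ex * (tx v - sx v) + ey * (ty v - sy v)) \<and>
      (\<forall>j<length A. v i (3 * j) = 1 \<longrightarrow>
        \<not> (0 < ex * (v i (3 * j + 1) - sx v) + ey * (v i (3 * j + 2) - sy v) \<and>
           ex * (v i (3 * j + 1) - sx v) + ey * (v i (3 * j + 2) - sy v)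
             < ex * (tx v - sx v) + ey * (ty v - sy v) \<and>
           v i (3 * j + 1)
             = sx v + dx * (ex * (v i (3 * j + 1) - sx v) + ey * (v i (3 * j + 2) - sy v)) \<and>
           v i (3 * j + 2)
             = sy v + dy * (ex * (v i (3 * j + 1) - sx v) + ey * (v i (3 * j + 2) - sy v)))))"
    by (intro presburger_intros assms)
  then show "presburger (\<lambda>v. slides_along d (decode A (v i)) (sx v, sy v) (tx v, ty v))"
    unfolding d slides_along_linear[OF unit] Ball_pieces_decode decode_piece_simps
      fst_conv snd_conv .
qed

lemma presburger_neq_square:
  assumes "affine sx" "affine sy" "affine tx" "affine ty"
  shows "presburger (\<lambda>v. (tx v, ty v) \<noteq> (sx v, sy v))"
  unfolding prod.inject by (intro presburger_intros assms)

lemma presburger_reaches: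
  assumes "affine sx" "affine sy" "affine tx" "affine ty"
  shows "presburger (\<lambda>v. reaches (decode A (v i)) ty' (sx v, sy v) (tx v, ty v))"
proof -
  obtain c k where ty': "ty' = (c, k)" by fastforce
  show ?thesis
  proof (cases k)
    case King
    then show ?thesis unfolding ty'
      by (simp only: reaches.simps fst_conv snd_conv)
        (intro presburger.conj presburger_neq_square presburger_abs_le affine_diff assms)
  next
    case Knight
    then show ?thesis unfolding ty'
      by (simp only: reaches.simps fst_conv snd_conv)
        (intro presburger_disj presburger.conj presburger_abs_eq affine_diff assms)
  next
    case Pawn
    have "presburger (\<lambda>v. \<bar>tx v - sx v\<bar> = 1)"
      by (intro presburger_abs_eq affine_diff assms)
    moreover have "presburger (\<lambda>v. ty v = sy v + forward c)"
      by (intro presburger_intros assms)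
    ultimately show ?thesis unfolding ty' Pawn
      by (simp only: reaches.simps fst_conv snd_conv) (rule presburger.conj)
  qed (simp_all only: ty' reaches.simps, (intro presburger_slides assms; blast)+)
qed

lemma presburger_attacks:
  assumes "affine tx" "affine ty"
  shows "presburger (\<lambda>v. attacks (decode A (v i)) (decode_piece A (v i) j) (tx v, ty v))"
  unfolding attacks_def decode_piece_simps
  by (intro presburger_intros presburger_reaches assms)

lemma presburger_in_check: "presburger (\<lambda>v. in_check c (decode A (v i)))"
  unfolding in_check_def Bex_pieces_decode decode_piece_simps
  by (intro presburger_intros presburger_attacks)

lemma presburger_can_move:
  assumes "affine tx" "affine ty"
  shows "presburger (\<lambda>v. can_move (decode A (v i)) (decode_piece A (v i) j) (tx v, ty v))"
  unfolding can_move_def decode_piece_simps fst_conv snd_conv prod.inject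
  by (cases "snd (A ! j) = Pawn"; simp only: if_True if_False)
    (intro presburger_intros presburger_attacks presburger_occupied presburger_occupied_by assms)+

lemma presburger_turn: "presburger (\<lambda>v. turn (decode A (v i)) = c)"
proof -
  have "(turn (decode A u) = c) = (if c = White then u (3 * length A) = 0 else u (3 * length A) \<noteq> 0)"
    for u by (cases c) (simp_all add: decode_simps)
  then show ?thesis
    by (cases "c = White") (simp_all only: if_True if_False simp_thms, (intro presburger_intros)+)
qed

text \<open>The target square need not be quantified over: it is where the moved piece stands in the
  resulting position.\<close>

lemma one_move_iff:
  "one_move p q \<longleftrightarrow> (\<exists>i<length (pieces p).
     turn p = pcolor (pieces p ! i) \<and>
     can_move p (pieces p ! i) (loc (pieces q ! i)) \<and>
     q = make_move p i (loc (pieces q ! i)) \<and> \<not> in_check (pcolor (pieces p ! i)) q)"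
proof -
  have "loc (pieces (make_move p i t) ! i) = t" if "i < length (pieces p)" for i t
    using that by (simp add: make_move_def Let_def)
  then show ?thesis unfolding one_move_def by metis
qed

lemma eq_make_move_iff:
  "q = make_move p i t \<longleftrightarrow>
     turn q = opponent (turn p) \<and> length (pieces q) = length (pieces p) \<and>
     (\<forall>j<length (pieces p). pieces q ! j =
        (let a = pieces p ! j in
         if j = i then a\<lparr>loc := t\<rparr>
         else if live a \<and> loc a = t then a\<lparr>live := False, loc := default_loc\<rparr> else a))"
proof -
  have "q = r \<longleftrightarrow> turn q = turn r \<and> length (pieces q) = length (pieces r) \<and>
      (\<forall>j<length (pieces r). pieces q ! j = pieces r ! j)" for r
    by (cases q; cases r) (auto simp: list_eq_iff_nth_eq)
  then show ?thesis by (simp add: make_move_def)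
qed

lemma decode_eq_make_move_iff:
  "decode A u = make_move (decode A w) i (x, y) \<longleftrightarrow>
    (u (3 * length A) = 0 \<longleftrightarrow> w (3 * length A) \<noteq> 0) \<and>
    (\<forall>j<length A.
      if j = i then (u (3 * j) = 1 \<longleftrightarrow> w (3 * j) = 1) \<and> u (3 * j + 1) = x \<and> u (3 * j + 2) = y
      else if w (3 * j) = 1 \<and> w (3 * j + 1) = x \<and> w (3 * j + 2) = y
        then u (3 * j) \<noteq> 1 \<and> u (3 * j + 1) = 0 \<and> u (3 * j + 2) = 0
      else (u (3 * j) = 1 \<longleftrightarrow> w (3 * j) = 1) \<and> u (3 * j + 1) = w (3 * j + 1)
        \<and> u (3 * j + 2) = w (3 * j + 2))"
proof -
  have piece: "decode_piece A u j =
      (let a = decode_piece A w j in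
       if j = i then a\<lparr>loc := (x, y)\<rparr>
       else if live a \<and> loc a = (x, y) then a\<lparr>live := False, loc := default_loc\<rparr> else a)
    \<longleftrightarrow> (if j = i then (u (3 * j) = 1 \<longleftrightarrow> w (3 * j) = 1) \<and> u (3 * j + 1) = x \<and> u (3 * j + 2) = y
       else if w (3 * j) = 1 \<and> w (3 * j + 1) = x \<and> w (3 * j + 2) = y
         then u (3 * j) \<noteq> 1 \<and> u (3 * j + 1) = 0 \<and> u (3 * j + 2) = 0
       else (u (3 * j) = 1 \<longleftrightarrow> w (3 * j) = 1) \<and> u (3 * j + 1) = w (3 * j + 1)
         \<and> u (3 * j + 2) = w (3 * j + 2))" for u w x y j
    by (auto simp: decode_piece_def Let_def default_loc_def)
  have turn: "turn (decode A u) = opponent (turn (decode A w))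
    \<longleftrightarrow> (u (3 * length A) = 0 \<longleftrightarrow> w (3 * length A) \<noteq> 0)" for u w
    by (simp add: decode_simps)
  show ?thesis
    unfolding eq_make_move_iff turn decode_simps(1) simp_thms
    by (intro arg_cong2[where f = "(\<and>)"] all_cong1 imp_cong refl)
      (simp only: decode_simps(2) piece)
qed

lemma presburger_make_move:
  assumes "affine x" "affine y"
  shows "presburger (\<lambda>v. decode A (v b) = make_move (decode A (v a)) i (x v, y v))"
  unfolding decode_eq_make_move_iff
  by (intro presburger_intros assms)

lemma one_move_decode_iff:
  "one_move (decode A u) (decode A w) \<longleftrightarrow>
    (\<exists>i<length A. turn (decode A u) = fst (A ! i) \<and>
       can_move (decode A u) (decode_piece A u i) (w (3 * i + 1), w (3 * i + 2)) \<and>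
       decode A w = make_move (decode A u) i (w (3 * i + 1), w (3 * i + 2)) \<and>
       \<not> in_check (fst (A ! i)) (decode A w))"
  unfolding one_move_iff decode_simps(1)
  by (intro ex_cong1 conj_cong refl) (simp_all add: decode_simps(2))

lemma presburger_one_move: "presburger (\<lambda>v. one_move (decode A (v a)) (decode A (v b)))"
  unfolding one_move_decode_iff
proof (rule presburger_ex_less)
  fix i assume "i < length A"
  then show "presburger (\<lambda>v. turn (decode A (v a)) = fst (A ! i) \<and>
       can_move (decode A (v a)) (decode_piece A (v a) i) (v b (3 * i + 1), v b (3 * i + 2)) \<and>
       decode A (v b) = make_move (decode A (v a)) i (v b (3 * i + 1), v b (3 * i + 2)) \<and>
       \<not> in_check (fst (A ! i)) (decode A (v b)))"
    by (intro presburger.conj presburger.neg presburger_turn presburger_can_move affine.var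
        presburger_make_move presburger_in_check)
qed

lemma presburger_valid_position:
  assumes "piece_list A"
  shows "presburger (\<lambda>v. decode A (v i) \<in> positions A)"
proof -
  have "decode A u \<in> positions A \<longleftrightarrow>
    (\<forall>j<length A. \<not> u (3 * j) = 1 \<longrightarrow> u (3 * j + 1) = 0 \<and> u (3 * j + 2) = 0) \<and>
    (\<forall>j<length A. \<forall>k<length A. u (3 * j) = 1 \<and> u (3 * k) = 1 \<and>
       u (3 * j + 1) = u (3 * k + 1) \<and> u (3 * j + 2) = u (3 * k + 2) \<longrightarrow> j = k)" for u
    unfolding positions_def valid_position_def Ball_pieces_decode mem_Collect_eq
      decode_simps(1,4)
    by (simp add: assms decode_simps(2) default_loc_def)
  then show ?thesis
    by (simp only:) (intro presburger_intros)
qed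

lemma presburger_normal_vector: "presburger (\<lambda>v. normal_vector A (v i))"
  unfolding normal_vector_def by (intro presburger_intros)

text \<open>Restricting a Presburger predicate to codes of positions keeps it Presburger, because
  normality of the code and validity of the position are conditions on finitely many entries.\<close>

lemma presburger_relation_positions:
  assumes "piece_list A"
    and P: "presburger (\<lambda>v. P (map (\<lambda>i. decode A (v i)) [0..<k]))"
  shows "presburger_relation (3 * length A + 1) k
    (map encode ` {ps. length ps = k \<and> set ps \<subseteq> positions A \<and> P ps})"
proof -
  let ?m = "3 * length A + 1"
  let ?Q = "\<lambda>v. (\<forall>i<k. normal_vector A (v i) \<and> decode A (v i) \<in> positions A)
    \<and> P (map (\<lambda>i. decode A (v i)) [0..<k])"
  have "presburger ?Q"
    by (intro presburger_intros presburger_normal_vector presburger_valid_position assms)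
  moreover have "map encode ` {ps. length ps = k \<and> set ps \<subseteq> positions A \<and> P ps}
    = {vs. length vs = k \<and> set vs \<subseteq> vectors ?m \<and> ?Q (tuple vs)}" (is "?L = ?R")
  proof
    show "?L \<subseteq> ?R"
    proof clarify
      fix ps assume ps: "k = length ps" "set ps \<subseteq> positions A" "P ps"
      have enc: "decode A (encode p) = p" "normal_vector A (encode p)" "encode p \<in> vectors ?m"
        if "p \<in> set ps" for p
        using decode_encode encode_normal subsetD[OF ps(2) that] by (auto simp: positions_def)
      have "map (\<lambda>i. decode A (tuple (map encode ps) i)) [0..<length ps] = ps"
        using enc(1) by (auto simp: tuple_def intro!: nth_equalityI)
      then show "length (map encode ps) = length ps \<and> set (map encode ps) \<subseteq> vectors ?m \<and>
        (\<forall>i<length ps. normal_vector A (tuple (map encode ps) i)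
          \<and> decode A (tuple (map encode ps) i) \<in> positions A)
        \<and> P (map (\<lambda>i. decode A (tuple (map encode ps) i)) [0..<length ps])"
        using enc ps by (auto simp: tuple_def)
    qed
    show "?R \<subseteq> ?L"
    proof
      fix vs assume vs: "vs \<in> ?R"
      have tuple_nth: "tuple vs i = vs ! i" if "i < k" for i
        using vs that by (simp add: tuple_def)
      have ps: "map (\<lambda>i. decode A (tuple vs i)) [0..<k] = map (decode A) vs"
        using vs tuple_nth by (auto intro!: nth_equalityI)
      have good: "normal_vector A v \<and> decode A v \<in> positions A \<and> v \<in> vectors ?m"
        if v: "v \<in> set vs" for v
      proof -
        obtain i where "i < k" "v = vs ! i" using v vs by (auto simp: in_set_conv_nth)
        then show ?thesis using vs v tuple_nth by auto
      qed
      have "map encode (map (decode A) vs) = vs"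
        using good encode_decode by (simp add: map_idI)
      moreover have "map (decode A) vs \<in> {ps. length ps = k \<and> set ps \<subseteq> positions A \<and> P ps}"
        using vs good ps by auto
      ultimately show "vs \<in> ?L" by (rule image_eqI[OF sym])
    qed
  qed
  ultimately show ?thesis unfolding presburger_relation_def by blast
qed

theorem lemma1:
  fixes A :: "piece_type list"
  assumes "piece_list A"
  shows "automatic (chess_structure A)"
proof (rule automatic_if_presburger)
  let ?m = "3 * length A + 1"
  have unary: "presburger_relation ?m 1 (map encode ` {[p] |p. p \<in> positions A \<and> P p})"
    if "presburger (\<lambda>v. P (decode A (v 0)))" for P
  proof -
    have "{[p] |p. p \<in> positions A \<and> P p}
      = {ps. length ps = 1 \<and> set ps \<subseteq> positions A \<and> P (ps ! 0)}"
      by (auto simp: length_Suc_conv)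
    then show ?thesis
      using presburger_relation_positions[OF assms, of "\<lambda>ps. P (ps ! 0)" 1] that by simp
  qed
  have binary: "presburger_relation ?m 2
      (map encode ` {[p, q] |p q. p \<in> positions A \<and> q \<in> positions A \<and> one_move p q})"
  proof -
    have "{[p, q] |p q. p \<in> positions A \<and> q \<in> positions A \<and> one_move p q}
      = {ps. length ps = 2 \<and> set ps \<subseteq> positions A \<and> one_move (ps ! 0) (ps ! 1)}"
      by (auto simp: length_Suc_conv numeral_2_eq_2)
    then show ?thesis
      using presburger_relation_positions[OF assms, of "\<lambda>ps. one_move (ps ! 0) (ps ! 1)" 2]
        presburger_one_move by simp
  qed
  show "inj_on encode (universe (chess_structure A))"
    by (rule inj_on_inverseI[of _ "decode A"])
      (simp add: chess_structure_def positions_def decode_encode)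
  have "{[p] |p. p \<in> positions A \<and> True} = (\<lambda>p. [p]) ` positions A"
    by auto
  then have "(\<lambda>p. [encode p]) ` positions A = map encode ` {[p] |p. p \<in> positions A \<and> True}"
    by (simp add: image_image)
  then show "presburger_relation ?m 1 ((\<lambda>p. [encode p]) ` universe (chess_structure A))"
    using unary[of "\<lambda>_. True"] presburger_const by (simp add: chess_structure_def)
  show "presburger_relation ?m k (map encode ` R)"
    if "(k, R) \<in> set (relations (chess_structure A))" for k R
    using that unary[OF presburger_turn[of A 0 White]] binary
      unary[OF presburger_in_check[of Black A 0]] unary[OF presburger_in_check[of White A 0]]
    by (auto simp: chess_structure_def)
qed

end
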